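(* Let $\mathbf G$ be a non-trivial integral residuated lattice, let $I_1\subseteq I_0$ be sets with $|I_0|=\aleph_0$, let $\lambda\colon I_1\to I_0$ be injective, and suppose that the kite $K^\lambda_{I_0,I_1}(\mathbf G)$ is subdirectly irreducible. Then $K^\lambda_{I_0,I_1}(\mathbf G)$ is isomorphic to just one of the following kites: (1) $K^\lambda_{\mathbb Z,\mathbb Z}(\mathbf G)$ with $\lambda(i)=i+1$; (2) $K^\lambda_{\mathbb N,\mathbb N\setminus\{0\}}(\mathbf G)$ with $\lambda(i)=i-1$; (3) $K^\lambda_{\mathbb N,\mathbb N}(\mathbf G)$ with $\lambda(i)=i+1$.
   Context: $\mathbb N=\{0,1,2,\dots\}$. A residuated lattice is an algebra $\mathbf G=(G;\wedge,\vee,\cdot,\backslash,/,e)$ such that $(G;\wedge,\vee)$ is a lattice, $(G;\cdot,e)$ is a monoid, and $x\cdot y\le z$ iff $y\le x\backslash z$ iff $x\le z/y$ for all $x,y,z\in G$. It is integral if $x\le e$ for all $x\in G$; it is non-trivial if $G\ne\{e\}$. A non-trivial residuated lattice is subdirectly irreducible if it has a least non-identity congruence. The kite $K^\lambda_{I_0,I_1}(\mathbf G)$ ($I_1\subseteq I_0$ sets, $\lambda\colon I_1\to I_0$ injective) is the following integral residuated lattice. For $n\ge1$ put $I_{n+1}=\{i\in I_n: \lambda(i)\in I_n\}$. Then $\lambda^{m-n}$ is a well-defined injective map $I_m\to I_n$ for $n\le m$; $\lambda^{-m}$ denotes the inverse of $\lambda^m$ on its image. The universe is the disjoint union $\biguplus_{n\in\mathbb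 N}G^{I_n}$ (different $n$ always give disjoint parts; if $I_n=\emptyset$, $G^{I_n}$ is a singleton), with elements written $\langle x_i: i\in I_n\rangle$. Order: $\langle x_i: i\in I_n\rangle\le\langle y_i: i\in I_m\rangle$ iff $m<n$, or $m=n$ and $x_i\le y_i$ for all $i\in I_n$. Unit: $1\in G^{I_0}$ with all coordinates $e$. Product: $\langle x_i: i\in I_m\rangle\cdot\langle y_i: i\in I_n\rangle=\langle x_{\lambda^n(i)}y_i: i\in I_{m+n}\rangle$. Right division: $\langle y_i: i\in I_n\rangle/\!/\langle x_i: i\in I_m\rangle$ is $1$ if $m>n$; if $m\le n$ it is the element of $G^{I_{n-m}}$ with $i$-th coordinate $y_{\lambda^{-m}(i)}/x_{\lambda^{-m}(i)}$ if $i\in\lambda^m(I_n)$ and $e$ otherwise. Left division: $\langle y_i: i\in I_n\rangle\backslash\!\backslash\langle x_i: i\in I_m\rangle$ is $1$ if $n>m$; if $n\le m$ it is the element of $G^{I_{m-n}}$ with $i$-th coordinate $y_{\lambda^{m-n}(i)}\backslash x_i$ if $i\in I_m$ and $e$ otherwise. *)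

theory Defs
  imports "HOL-Algebra.Group" "HOL-Library.Countable_Set"
begin

section \<open>Residuated lattices\<close>

record 'a res_lattice = "'a monoid" +
  rl_meet :: "'a \<Rightarrow> 'a \<Rightarrow> 'a"
  rl_join :: "'a \<Rightarrow> 'a \<Rightarrow> 'a"
  rl_ldiv :: "'a \<Rightarrow> 'a \<Rightarrow> 'a"  \<comment> \<open>\<open>rl_ldiv G x z\<close> is the left residual written x backslash z\<close>
  rl_rdiv :: "'a \<Rightarrow> 'a \<Rightarrow> 'a"  \<comment> \<open>\<open>rl_rdiv G z y\<close> is the right residual z / y\<close>

definition rl_le :: "('a, 'm) res_lattice_scheme \<Rightarrow> 'a \<Rightarrow> 'a \<Rightarrow> bool" where
  "rl_le G x y \<longleftrightarrow> rl_meet G x y = x"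

locale residuated_lattice = monoid G for G (structure) +
  assumes meet_closed: "\<lbrakk>x \<in> carrier G; y \<in> carrier G\<rbrakk> \<Longrightarrow> rl_meet G x y \<in> carrier G"
    and join_closed: "\<lbrakk>x \<in> carrier G; y \<in> carrier G\<rbrakk> \<Longrightarrow> rl_join G x y \<in> carrier G"
    and ldiv_closed: "\<lbrakk>x \<in> carrier G; y \<in> carrier G\<rbrakk> \<Longrightarrow> rl_ldiv G x y \<in> carrier G"
    and rdiv_closed: "\<lbrakk>x \<in> carrier G; y \<in> carrier G\<rbrakk> \<Longrightarrow> rl_rdiv G x y \<in> carrier G"
    and meet_comm: "\<lbrakk>x \<in> carrier G; y \<in> carrier G\<rbrakk> \<Longrightarrow> rl_meet G x y = rl_meet G y x"
    and join_comm: "\<lbrakk>x \<in> carrier G; y \<in> carrier G\<rbrakk> \<Longrightarrow> rl_join G x y = rl_join G y x"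
    and meet_assoc: "\<lbrakk>x \<in> carrier G; y \<in> carrier G; z \<in> carrier G\<rbrakk>
          \<Longrightarrow> rl_meet G (rl_meet G x y) z = rl_meet G x (rl_meet G y z)"
    and join_assoc: "\<lbrakk>x \<in> carrier G; y \<in> carrier G; z \<in> carrier G\<rbrakk>
          \<Longrightarrow> rl_join G (rl_join G x y) z = rl_join G x (rl_join G y z)"
    and meet_absorb: "\<lbrakk>x \<in> carrier G; y \<in> carrier G\<rbrakk> \<Longrightarrow> rl_meet G x (rl_join G x y) = x"
    and join_absorb: "\<lbrakk>x \<in> carrier G; y \<in> carrier G\<rbrakk> \<Longrightarrow> rl_join G x (rl_meet G x y) = x"
    and residual_left: "\<lbrakk>x \<in> carrier G; y \<in> carrier G; z \<in> carrier G\<rbrakk>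
          \<Longrightarrow> rl_le G (x \<otimes> y) z \<longleftrightarrow> rl_le G y (rl_ldiv G x z)"
    and residual_right: "\<lbrakk>x \<in> carrier G; y \<in> carrier G; z \<in> carrier G\<rbrakk>
          \<Longrightarrow> rl_le G (x \<otimes> y) z \<longleftrightarrow> rl_le G x (rl_rdiv G z y)"

locale integral_residuated_lattice = residuated_lattice G for G (structure) +
  assumes integral: "x \<in> carrier G \<Longrightarrow> rl_le G x \<one>"

definition rl_nontrivial :: "('a, 'm) res_lattice_scheme \<Rightarrow> bool" where
  "rl_nontrivial G \<longleftrightarrow> carrier G \<noteq> {\<one>\<^bsub>G\<^esub>}"

definition rl_congruence :: "('a, 'm) res_lattice_scheme \<Rightarrow> ('a \<times> 'a) set \<Rightarrow> bool" where
  "rl_congruence G \<theta> \<longleftrightarrow> equiv (carrier G) \<theta> \<and>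
     (\<forall>(x, x') \<in> \<theta>. \<forall>(y, y') \<in> \<theta>.
        (x \<otimes>\<^bsub>G\<^esub> y, x' \<otimes>\<^bsub>G\<^esub> y') \<in> \<theta> \<and>
        (rl_meet G x y, rl_meet G x' y') \<in> \<theta> \<and>
        (rl_join G x y, rl_join G x' y') \<in> \<theta> \<and>
        (rl_ldiv G x y, rl_ldiv G x' y') \<in> \<theta> \<and>
        (rl_rdiv G x y, rl_rdiv G x' y') \<in> \<theta>)"

definition subdirectly_irreducible :: "('a, 'm) res_lattice_scheme \<Rightarrow> bool" where
  "subdirectly_irreducible G \<longleftrightarrow> rl_nontrivial G \<and>
     (\<exists>\<theta>. rl_congruence G \<theta> \<and> \<theta> \<noteq> Id_on (carrier G) \<and>
        (\<forall>\<phi>. rl_congruence G \<phi> \<and> \<phi> \<noteq> Id_on (carrier G) \<longrightarrow> \<theta> \<subseteq> \<phi>))"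

definition rl_isomorphic ::
  "('a, 'm) res_lattice_scheme \<Rightarrow> ('b, 'n) res_lattice_scheme \<Rightarrow> bool" where
  "rl_isomorphic G H \<longleftrightarrow> (\<exists>h \<in> iso G H. h \<one>\<^bsub>G\<^esub> = \<one>\<^bsub>H\<^esub> \<and>
     (\<forall>x \<in> carrier G. \<forall>y \<in> carrier G.
        h (rl_meet G x y) = rl_meet H (h x) (h y) \<and>
        h (rl_join G x y) = rl_join H (h x) (h y) \<and>
        h (rl_ldiv G x y) = rl_ldiv H (h x) (h y) \<and>
        h (rl_rdiv G x y) = rl_rdiv H (h x) (h y)))"


section \<open>Kites\<close>

fun kite_index :: "'i set \<Rightarrow> 'i set \<Rightarrow> ('i \<Rightarrow> 'i) \<Rightarrow> nat \<Rightarrow> 'i set" where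
  "kite_index I0 I1 l 0 = I0"
| "kite_index I0 I1 l (Suc 0) = I1"
| "kite_index I0 I1 l (Suc (Suc n)) =
     {i \<in> kite_index I0 I1 l (Suc n). l i \<in> kite_index I0 I1 l (Suc n)}"

text \<open>
  The sequence \<open>\<langle>x\<^sub>i : i \<in> I\<^sub>n\<rangle>\<close> is the pair \<open>(n, x)\<close> with \<open>x\<close> extensional on \<open>I\<^sub>n\<close>;
  the tag \<open>n\<close> makes the union disjoint. The map \<open>l\<close> is only ever
  iterated inside \<open>I\<^sub>1\<close>, so its values elsewhere are irrelevant.
\<close>

definition kite_carrier ::
  "'i set \<Rightarrow> 'i set \<Rightarrow> ('i \<Rightarrow> 'i) \<Rightarrow> ('a, 'm) res_lattice_scheme \<Rightarrow> (nat \<times> ('i \<Rightarrow> 'a)) set" where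
  "kite_carrier I0 I1 l G = (SIGMA n:UNIV. kite_index I0 I1 l n \<rightarrow>\<^sub>E carrier G)"

definition kite_le ::
  "'i set \<Rightarrow> 'i set \<Rightarrow> ('i \<Rightarrow> 'i) \<Rightarrow> ('a, 'm) res_lattice_scheme
     \<Rightarrow> nat \<times> ('i \<Rightarrow> 'a) \<Rightarrow> nat \<times> ('i \<Rightarrow> 'a) \<Rightarrow> bool" where
  "kite_le I0 I1 l G = (\<lambda>(n, x) (m, y).
     m < n \<or> m = n \<and> (\<forall>i \<in> kite_index I0 I1 l n. rl_le G (x i) (y i)))"

text \<open>
  Meet and join are the lattice operations of the order \<open>kite_le\<close>
  (see \<open>rl_le_kite\<close> and \<open>kite_integral_residuated_lattice\<close> below).
\<close>

definition kite ::
  "'i set \<Rightarrow> 'i set \<Rightarrow> ('i \<Rightarrow> 'i) \<Rightarrow> ('a, 'm) res_lattice_scheme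
     \<Rightarrow> (nat \<times> ('i \<Rightarrow> 'a)) res_lattice" where
  "kite I0 I1 l G = (let I = kite_index I0 I1 l in
     \<lparr> carrier = kite_carrier I0 I1 l G,
       mult = (\<lambda>(m, x) (n, y). (m + n, \<lambda>i \<in> I (m + n). x ((l ^^ n) i) \<otimes>\<^bsub>G\<^esub> y i)),
       one = (0, \<lambda>i \<in> I 0. \<one>\<^bsub>G\<^esub>),
       rl_meet = (\<lambda>(m, x) (n, y).
         if m < n then (n, y) else if n < m then (m, x)
         else (m, \<lambda>i \<in> I m. rl_meet G (x i) (y i))),
       rl_join = (\<lambda>(m, x) (n, y).
         if m < n then (m, x) else if n < m then (n, y)
         else (m, \<lambda>i \<in> I m. rl_join G (x i) (y i))),
       rl_ldiv = (\<lambda>(n, y) (m, x).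
         if n > m then (0, \<lambda>i \<in> I 0. \<one>\<^bsub>G\<^esub>)
         else (m - n, \<lambda>i \<in> I (m - n).
           if i \<in> I m then rl_ldiv G (y ((l ^^ (m - n)) i)) (x i) else \<one>\<^bsub>G\<^esub>)),
       rl_rdiv = (\<lambda>(n, y) (m, x).
         if m > n then (0, \<lambda>i \<in> I 0. \<one>\<^bsub>G\<^esub>)
         else (n - m, \<lambda>i \<in> I (n - m).
           if i \<in> (l ^^ m) ` I n
           then rl_rdiv G (y (inv_into (I m) (l ^^ m) i)) (x (inv_into (I m) (l ^^ m) i))
           else \<one>\<^bsub>G\<^esub>)) \<rparr>)"

definition kite_Z :: "('a, 'm) res_lattice_scheme \<Rightarrow> (nat \<times> (int \<Rightarrow> 'a)) res_lattice" where
  "kite_Z G = kite UNIV UNIV (\<lambda>i. i + 1) G"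

definition kite_N_pred :: "('a, 'm) res_lattice_scheme \<Rightarrow> (nat \<times> (nat \<Rightarrow> 'a)) res_lattice" where
  "kite_N_pred G = kite UNIV (UNIV - {0}) (\<lambda>i. i - 1) G"

definition kite_N_succ :: "('a, 'm) res_lattice_scheme \<Rightarrow> (nat \<times> (nat \<Rightarrow> 'a)) res_lattice" where
  "kite_N_succ G = kite UNIV UNIV (\<lambda>i. i + 1) G"

lemma kite_index_Suc_subset:
  assumes "I1 \<subseteq> I0"
  shows "kite_index I0 I1 l (Suc n) \<subseteq> kite_index I0 I1 l n"
  using assms by (cases n) auto

lemma kite_index_antimono:
  assumes "I1 \<subseteq> I0" "m \<le> n"
  shows "kite_index I0 I1 l n \<subseteq> kite_index I0 I1 l m"
  using assms(2) kite_index_Suc_subset[OF assms(1)] by (rule lift_Suc_antimono_le[rotated])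

lemma kite_index_step:
  assumes "l \<in> I1 \<rightarrow> I0" "i \<in> kite_index I0 I1 l (Suc n)"
  shows "l i \<in> kite_index I0 I1 l n"
  using assms by (cases n) auto

lemma kite_index_funpow:
  assumes "l \<in> I1 \<rightarrow> I0" "i \<in> kite_index I0 I1 l (n + k)"
  shows "(l ^^ k) i \<in> kite_index I0 I1 l n"
  using assms(2)
proof (induction k arbitrary: n)
  case (Suc k)
  then have "(l ^^ k) i \<in> kite_index I0 I1 l (Suc n)" by simp
  then show ?case using kite_index_step[OF assms(1)] by simp
qed simp

lemma kite_index_funpow_diff:
  assumes "l \<in> I1 \<rightarrow> I0" "n \<le> m" "i \<in> kite_index I0 I1 l m"
  shows "(l ^^ (m - n)) i \<in> kite_index I0 I1 l n"
  using kite_index_funpow[of l I1 I0 i n "m - n"] assms by simp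

lemma inj_on_kite_index:
  assumes "I1 \<subseteq> I0" "l \<in> I1 \<rightarrow> I0" "inj_on l I1"
  shows "inj_on (l ^^ n) (kite_index I0 I1 l n)"
proof (induction n)
  case (Suc n)
  show ?case
  proof (rule inj_onI)
    fix i j assume i: "i \<in> kite_index I0 I1 l (Suc n)" and j: "j \<in> kite_index I0 I1 l (Suc n)"
      and eq: "(l ^^ Suc n) i = (l ^^ Suc n) j"
    have "(l ^^ n) i \<in> I1" "(l ^^ n) j \<in> I1"
      using kite_index_funpow[OF assms(2), of _ 1 n] i j by auto
    then have "(l ^^ n) i = (l ^^ n) j" using eq assms(3) by (auto dest: inj_onD)
    then show "i = j"
      using Suc i j kite_index_Suc_subset[OF assms(1)] by (meson inj_on_def subsetD)
  qed
qed simp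

lemma kite_index_iff:
  assumes "I1 \<subseteq> I0" "l \<in> I1 \<rightarrow> I0"
  shows "i \<in> kite_index I0 I1 l (m + n) \<longleftrightarrow>
    i \<in> kite_index I0 I1 l n \<and> (l ^^ n) i \<in> kite_index I0 I1 l m"
proof
  assume "i \<in> kite_index I0 I1 l (m + n)"
  then show "i \<in> kite_index I0 I1 l n \<and> (l ^^ n) i \<in> kite_index I0 I1 l m"
    using kite_index_funpow[OF assms(2)] kite_index_antimono[OF assms(1), of n "m + n" l]
    by (meson le_add2 subsetD)
next
  have step: "i \<in> kite_index I0 I1 l (Suc k) \<longleftrightarrow> i \<in> I1 \<and> l i \<in> kite_index I0 I1 l k" for i k
  proof (induction k)
    case 0
    then show ?case using assms(2) by auto
  next
    case (Suc k)
    then show ?case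
      using kite_index_antimono[OF assms(1), of "k" "Suc k" l]
      by auto
  qed
  have *: "i \<in> kite_index I0 I1 l n \<Longrightarrow> (l ^^ n) i \<in> kite_index I0 I1 l m \<Longrightarrow>
      i \<in> kite_index I0 I1 l (m + n)" for i
  proof (induction n arbitrary: i)
    case (Suc n)
    then show ?case using step[of i n] step[of i "m + n"] by (simp add: funpow_swap1)
  qed simp
  assume "i \<in> kite_index I0 I1 l n \<and> (l ^^ n) i \<in> kite_index I0 I1 l m"
  then show "i \<in> kite_index I0 I1 l (m + n)" using * by blast
qed

lemma (in residuated_lattice) le_refl: "x \<in> carrier G \<Longrightarrow> rl_le G x x"
  unfolding rl_le_def by (metis meet_absorb join_absorb meet_closed)

lemma kite_carrier_iff:
  "p \<in> kite_carrier I0 I1 l G \<longleftrightarrow> snd p \<in> kite_index I0 I1 l (fst p) \<rightarrow>\<^sub>E carrier G"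
  by (cases p) (simp add: kite_carrier_def)

lemma rl_le_kite:
  assumes "p \<in> carrier (kite I0 I1 l G)" "q \<in> carrier (kite I0 I1 l G)"
  shows "rl_le (kite I0 I1 l G) p q \<longleftrightarrow> kite_le I0 I1 l G p q"
proof -
  obtain m x n y where [simp]: "p = (m, x)" "q = (n, y)" by (metis surj_pair)
  have x: "x \<in> kite_index I0 I1 l m \<rightarrow>\<^sub>E carrier G"
    using assms by (simp add: kite_def Let_def kite_carrier_iff)
  have "(\<lambda>i \<in> kite_index I0 I1 l m. rl_meet G (x i) (y i)) = x \<longleftrightarrow>
      (\<forall>i \<in> kite_index I0 I1 l m. rl_meet G (x i) (y i) = x i)"
  proof
    assume "(\<lambda>i \<in> kite_index I0 I1 l m. rl_meet G (x i) (y i)) = x"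
    then show "\<forall>i \<in> kite_index I0 I1 l m. rl_meet G (x i) (y i) = x i"
      by (metis restrict_apply')
  next
    assume "\<forall>i \<in> kite_index I0 I1 l m. rl_meet G (x i) (y i) = x i"
    then show "(\<lambda>i \<in> kite_index I0 I1 l m. rl_meet G (x i) (y i)) = x"
      using x by (intro extensionalityI[where A = "kite_index I0 I1 l m"]) (auto simp: PiE_def)
  qed
  then show ?thesis
    by (auto simp: rl_le_def kite_le_def kite_def Let_def)
qed

theorem kite_integral_residuated_lattice:
  assumes "integral_residuated_lattice G" "I1 \<subseteq> I0" "l \<in> I1 \<rightarrow> I0" "inj_on l I1"
  shows "integral_residuated_lattice (kite I0 I1 l G)"
proof -
  interpret G: integral_residuated_lattice G by fact
  define I where "I = kite_index I0 I1 l"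
  define K where "K = kite I0 I1 l G"
  have cK: "carrier K = (SIGMA n:UNIV. I n \<rightarrow>\<^sub>E carrier G)"
    by (simp add: K_def kite_def kite_carrier_def Let_def I_def)
  have mK: "(m, x) \<otimes>\<^bsub>K\<^esub> (n, y) = (m + n, \<lambda>i \<in> I (m + n). x ((l ^^ n) i) \<otimes>\<^bsub>G\<^esub> y i)" for m x n y
    by (simp add: K_def kite_def Let_def I_def)
  have oK: "\<one>\<^bsub>K\<^esub> = (0, \<lambda>i \<in> I 0. \<one>\<^bsub>G\<^esub>)"
    by (simp add: K_def kite_def Let_def I_def)
  have meetK: "rl_meet K (m, x) (n, y) = (if m < n then (n, y) else if n < m then (m, x)
         else (m, \<lambda>i \<in> I m. rl_meet G (x i) (y i)))" for m x n y
    by (simp add: K_def kite_def Let_def I_def)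
  have joinK: "rl_join K (m, x) (n, y) = (if m < n then (m, x) else if n < m then (n, y)
         else (m, \<lambda>i \<in> I m. rl_join G (x i) (y i)))" for m x n y
    by (simp add: K_def kite_def Let_def I_def)
  have ldivK: "rl_ldiv K (n, y) (m, x) = (if n > m then (0, \<lambda>i \<in> I 0. \<one>\<^bsub>G\<^esub>)
         else (m - n, \<lambda>i \<in> I (m - n).
           if i \<in> I m then rl_ldiv G (y ((l ^^ (m - n)) i)) (x i) else \<one>\<^bsub>G\<^esub>))" for m x n y
    by (simp add: K_def kite_def Let_def I_def)
  have rdivK: "rl_rdiv K (n, y) (m, x) = (if m > n then (0, \<lambda>i \<in> I 0. \<one>\<^bsub>G\<^esub>)
         else (n - m, \<lambda>i \<in> I (n - m).
           if i \<in> (l ^^ m) ` I n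
           then rl_rdiv G (y (inv_into (I m) (l ^^ m) i)) (x (inv_into (I m) (l ^^ m) i))
           else \<one>\<^bsub>G\<^esub>))" for m x n y
    unfolding K_def kite_def Let_def I_def by simp
  have leK: "rl_le K (n, x) (m, y) \<longleftrightarrow> m < n \<or> m = n \<and> (\<forall>i \<in> I n. rl_le G (x i) (y i))"
    if "(n, x) \<in> carrier K" "(m, y) \<in> carrier K" for n x m y
    using rl_le_kite[of "(n, x)" I0 I1 l G "(m, y)"] that
    by (simp add: K_def I_def kite_le_def)
  have anti: "I n \<subseteq> I m" if "m \<le> n" for m n
    using kite_index_antimono[OF assms(2) that] by (simp add: I_def)
  have pow: "(l ^^ k) i \<in> I n" if "i \<in> I (n + k)" for i n k
    using kite_index_funpow[OF assms(3)] that by (simp add: I_def)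
  have powd: "(l ^^ (m - n)) i \<in> I n" if "i \<in> I m" "n \<le> m" for i n m
    using pow[of i n "m - n"] that by simp
  have iff: "i \<in> I (m + n) \<longleftrightarrow> i \<in> I n \<and> (l ^^ n) i \<in> I m" for i m n
    using kite_index_iff[OF assms(2,3)] by (simp add: I_def)
  have inj: "inj_on (l ^^ n) (I n)" for n
    using inj_on_kite_index[OF assms(2-4)] by (simp add: I_def)
  have inv: "inv_into (I m) (l ^^ m) ((l ^^ m) i) = i" if "i \<in> I n" "m \<le> n" for i m n
    using that inj anti by (meson inv_into_f_f subsetD)
  have K_closed: "(m, x) \<otimes>\<^bsub>K\<^esub> (n, y) \<in> carrier K"
    if "(m, x) \<in> carrier K" "(n, y) \<in> carrier K" for m x n y
    using that iff by (auto simp: mK cK PiE_iff)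
  have one_closed: "\<one>\<^bsub>K\<^esub> \<in> carrier K"
    by (auto simp: oK cK)
  have ld_closed: "rl_ldiv K (n, y) (m, x) \<in> carrier K"
    if "(n, y) \<in> carrier K" "(m, x) \<in> carrier K" for m x n y
    using that powd[of _ m n] by (auto simp: ldivK cK PiE_iff intro!: G.ldiv_closed)
  have rd_closed: "rl_rdiv K (n, y) (m, x) \<in> carrier K"
    if "(n, y) \<in> carrier K" "(m, x) \<in> carrier K" for m x n y
  proof -
    have "i \<in> I m" if "i \<in> I n" "\<not> n < m" for i
      using that anti[of m n] by (meson not_less subsetD)
    then show ?thesis
      using that inv by (auto simp: rdivK cK PiE_iff intro!: G.rdiv_closed)
  qed
  have "integral_residuated_lattice K"
  proof (unfold_locales, goal_cases)
    case (1 p q)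
    then show ?case using K_closed by (cases p, cases q) blast
  next
    case (2 p q r)
    obtain m x n y k z where pqr: "p = (m, x)" "q = (n, y)" "r = (k, z)" by (metis surj_pair)
    have "x ((l ^^ (n + k)) i) \<otimes>\<^bsub>G\<^esub> (y ((l ^^ k) i) \<otimes>\<^bsub>G\<^esub> z i)
        = (x ((l ^^ n) ((l ^^ k) i)) \<otimes>\<^bsub>G\<^esub> y ((l ^^ k) i)) \<otimes>\<^bsub>G\<^esub> z i"
      if i: "i \<in> I (m + n + k)" for i
    proof -
      have a: "i \<in> I k" "(l ^^ k) i \<in> I n" "(l ^^ n) ((l ^^ k) i) \<in> I m"
        using i iff by blast+
      then have "x ((l ^^ n) ((l ^^ k) i)) \<in> carrier G" "y ((l ^^ k) i) \<in> carrier G" "z i \<in> carrier G"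
        using 2 pqr by (auto simp: cK PiE_iff)
      moreover have "(l ^^ (n + k)) i = (l ^^ n) ((l ^^ k) i)" by (simp add: funpow_add)
      ultimately show ?thesis by (simp add: G.m_assoc)
    qed
    moreover have "i \<in> I (n + k)" "(l ^^ k) i \<in> I (m + n)" if "i \<in> I (m + n + k)" for i
      using that iff by (metis add.assoc)+
    ultimately show ?case
      unfolding pqr mK by (auto simp: add.assoc intro!: restrict_ext)
  next
    case 3
    show ?case by (rule one_closed)
  next
    case (4 p)
    obtain m x where p: "p = (m, x)" by (metis surj_pair)
    have "(l ^^ m) i \<in> I 0" if "i \<in> I m" for i using pow[of i 0 m] that by simp
    then show ?case using 4 by (auto simp: p oK mK cK PiE_iff extensional_def restrict_def)
  next
    case (5 p)
    obtain m x where p: "p = (m, x)" by (metis surj_pair)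
    have "i \<in> I 0" if "i \<in> I m" for i using anti[of 0 m] that by auto
    then show ?case using 5 by (auto simp: p oK mK cK PiE_iff extensional_def restrict_def)
  next
    case (6 p q)
    then show ?case by (cases p, cases q) (auto simp: meetK cK PiE_iff intro!: G.meet_closed)
  next
    case (7 p q)
    then show ?case by (cases p, cases q) (auto simp: joinK cK PiE_iff intro!: G.join_closed)
  next
    case (8 p q)
    then show ?case using ld_closed by (cases p, cases q) blast
  next
    case (9 p q)
    then show ?case using rd_closed by (cases p, cases q) blast
  next
    case (10 p q)
    then show ?case by (cases p, cases q)
      (auto simp: meetK cK PiE_iff intro!: restrict_ext G.meet_comm)
  next
    case (11 p q)
    then show ?case by (cases p, cases q)
      (auto simp: joinK cK PiE_iff intro!: restrict_ext G.join_comm)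
  next
    case (12 p q r)
    obtain m x n y k z where pqr: "p = (m, x)" "q = (n, y)" "r = (k, z)" by (metis surj_pair)
    show ?case using 12 unfolding pqr
      by (cases m n rule: linorder_cases; cases n k rule: linorder_cases)
        (auto simp: meetK cK PiE_iff intro!: restrict_ext G.meet_assoc)
  next
    case (13 p q r)
    obtain m x n y k z where pqr: "p = (m, x)" "q = (n, y)" "r = (k, z)" by (metis surj_pair)
    show ?case using 13 unfolding pqr
      by (cases m n rule: linorder_cases; cases n k rule: linorder_cases)
        (auto simp: joinK cK PiE_iff intro!: restrict_ext G.join_assoc)
  next
    case (14 p q)
    have idem: "rl_meet G a a = a" if "a \<in> carrier G" for a
      using G.le_refl[OF that] by (simp add: rl_le_def)
    show ?case using 14 by (cases p, cases q)
      (auto simp: meetK joinK cK PiE_iff extensional_def restrict_def idem G.meet_absorb)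
  next
    case (15 p q)
    have idem: "rl_join G a a = a" if "a \<in> carrier G" for a
      using G.le_refl[OF that] G.join_absorb[OF that that] by (simp add: rl_le_def)
    show ?case using 15 by (cases p, cases q)
      (auto simp: meetK joinK cK PiE_iff extensional_def restrict_def idem G.join_absorb)
  next
    case (16 p q r)
    obtain m x n y k z where pqr: "p = (m, x)" "q = (n, y)" "r = (k, z)" by (metis surj_pair)
    have c: "p \<in> carrier K" "q \<in> carrier K" "r \<in> carrier K" by fact+
    have xyz: "\<And>i. i \<in> I m \<Longrightarrow> x i \<in> carrier G" "\<And>i. i \<in> I n \<Longrightarrow> y i \<in> carrier G"
        "\<And>i. i \<in> I k \<Longrightarrow> z i \<in> carrier G"
      using c pqr by (auto simp: cK PiE_iff)
    have L: "rl_le K (p \<otimes>\<^bsub>K\<^esub> q) r \<longleftrightarrow> k < m + n \<or>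
       k = m + n \<and> (\<forall>i \<in> I (m + n). rl_le G (x ((l ^^ n) i) \<otimes>\<^bsub>G\<^esub> y i) (z i))"
      using K_closed[of m x n y] c unfolding pqr by (subst mK, subst leK) (auto simp: mK)
    show ?case
    proof (cases "m > k")
      case True
      then show ?thesis
        using L leK[of n y 0 "\<lambda>i \<in> I 0. \<one>\<^bsub>G\<^esub>"] one_closed c xyz
        by (auto simp: pqr ldivK oK G.integral)
    next
      case False
      have "rl_le K q (rl_ldiv K p r) \<longleftrightarrow> k - m < n \<or> k - m = n \<and>
        (\<forall>i \<in> I n. rl_le G (y i) (if i \<in> I k then rl_ldiv G (x ((l ^^ (k - m)) i)) (z i) else \<one>\<^bsub>G\<^esub>))"
        using ld_closed[of m x k z] c False unfolding pqr
        by (subst ldivK, simp, subst leK) (auto simp: ldivK)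
      moreover have "(\<forall>i \<in> I (m + n). rl_le G (x ((l ^^ n) i) \<otimes>\<^bsub>G\<^esub> y i) (z i)) \<longleftrightarrow>
        (\<forall>i \<in> I n. rl_le G (y i) (if i \<in> I k then rl_ldiv G (x ((l ^^ (k - m)) i)) (z i) else \<one>\<^bsub>G\<^esub>))"
        if k: "k = m + n"
      proof -
        have "rl_le G (x ((l ^^ n) i) \<otimes>\<^bsub>G\<^esub> y i) (z i) \<longleftrightarrow> rl_le G (y i) (rl_ldiv G (x ((l ^^ n) i)) (z i))"
          if "i \<in> I (m + n)" for i
          using that iff xyz k by (intro G.residual_left) auto
        moreover have "I (m + n) \<subseteq> I n" using anti by simp
        ultimately show ?thesis using k xyz by (auto simp: G.integral)
      qed
      ultimately show ?thesis using L False by auto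
    qed
  next
    case (17 p q r)
    obtain m x n y k z where pqr: "p = (m, x)" "q = (n, y)" "r = (k, z)" by (metis surj_pair)
    have c: "p \<in> carrier K" "q \<in> carrier K" "r \<in> carrier K" by fact+
    have xyz: "\<And>i. i \<in> I m \<Longrightarrow> x i \<in> carrier G" "\<And>i. i \<in> I n \<Longrightarrow> y i \<in> carrier G"
        "\<And>i. i \<in> I k \<Longrightarrow> z i \<in> carrier G"
      using c pqr by (auto simp: cK PiE_iff)
    have L: "rl_le K (p \<otimes>\<^bsub>K\<^esub> q) r \<longleftrightarrow> k < m + n \<or>
       k = m + n \<and> (\<forall>i \<in> I (m + n). rl_le G (x ((l ^^ n) i) \<otimes>\<^bsub>G\<^esub> y i) (z i))"
      using K_closed[of m x n y] c unfolding pqr by (subst mK, subst leK) (auto simp: mK)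
    show ?case
    proof (cases "n > k")
      case True
      then show ?thesis
        using L leK[of m x 0 "\<lambda>i \<in> I 0. \<one>\<^bsub>G\<^esub>"] one_closed c xyz
        by (auto simp: pqr rdivK oK G.integral)
    next
      case False
      let ?v = "inv_into (I n) (l ^^ n)"
      have "rl_le K p (rl_rdiv K r q) \<longleftrightarrow> k - n < m \<or> k - n = m \<and>
        (\<forall>i \<in> I m. rl_le G (x i) (if i \<in> (l ^^ n) ` I k then rl_rdiv G (z (?v i)) (y (?v i)) else \<one>\<^bsub>G\<^esub>))"
        using rd_closed[of k z n y] c False unfolding pqr
        by (subst rdivK, simp, subst leK) (auto simp: rdivK)
      moreover have "(\<forall>i \<in> I (m + n). rl_le G (x ((l ^^ n) i) \<otimes>\<^bsub>G\<^esub> y i) (z i)) \<longleftrightarrow>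
        (\<forall>i \<in> I m. rl_le G (x i) (if i \<in> (l ^^ n) ` I k then rl_rdiv G (z (?v i)) (y (?v i)) else \<one>\<^bsub>G\<^esub>))"
        if k: "k = m + n"
      proof -
        have r: "rl_le G (x ((l ^^ n) i) \<otimes>\<^bsub>G\<^esub> y i) (z i) \<longleftrightarrow> rl_le G (x ((l ^^ n) i)) (rl_rdiv G (z i) (y i))"
          if "i \<in> I (m + n)" for i
          using that iff xyz k by (intro G.residual_right) auto
        have v: "?v ((l ^^ n) i) = i" "(l ^^ n) i \<in> I m" if "i \<in> I (m + n)" for i
          using that inv[of i "m + n" n] pow by auto
        show ?thesis
        proof
          assume "\<forall>i \<in> I (m + n). rl_le G (x ((l ^^ n) i) \<otimes>\<^bsub>G\<^esub> y i) (z i)"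
          then show "\<forall>i \<in> I m. rl_le G (x i) (if i \<in> (l ^^ n) ` I k then rl_rdiv G (z (?v i)) (y (?v i)) else \<one>\<^bsub>G\<^esub>)"
            using r v k xyz by (auto simp: G.integral)
        next
          assume A: "\<forall>i \<in> I m. rl_le G (x i) (if i \<in> (l ^^ n) ` I k then rl_rdiv G (z (?v i)) (y (?v i)) else \<one>\<^bsub>G\<^esub>)"
          show "\<forall>i \<in> I (m + n). rl_le G (x ((l ^^ n) i) \<otimes>\<^bsub>G\<^esub> y i) (z i)"
          proof
            fix i assume i: "i \<in> I (m + n)"
            then show "rl_le G (x ((l ^^ n) i) \<otimes>\<^bsub>G\<^esub> y i) (z i)"
              using A[rule_format, OF v(2)[OF i]] r[OF i] v(1)[OF i] k by auto
          qed
        qed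
      qed
      ultimately show ?thesis using L False by auto
    qed
  next
    case (18 p)
    obtain m x where p: "p = (m, x)" by (metis surj_pair)
    show ?case using 18 leK[of m x 0 "\<lambda>i \<in> I 0. \<one>\<^bsub>G\<^esub>"] one_closed
      by (auto simp: p oK cK PiE_iff G.integral)
  qed
  then show ?thesis by (simp add: K_def)
qed

end

theory Submission
  imports Defs
begin

text \<open>
  View \<open>l\<close> as a directed graph on \<open>I0\<close> with an edge from \<open>i\<close> to \<open>l i\<close> for every \<open>i \<in> I1\<close>. The
  operations of the kite compute each coordinate from coordinates in the same connected component.
  Hence, for a union \<open>A\<close> of components, ``the coordinates in \<open>A\<close> agree'' is a congruence, and so is
  ``the coordinates outside \<open>A\<close> agree''. The two meet in the identity, and if \<open>A\<close> is neither empty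
  nor everything, both differ from the identity because \<open>G\<close> is non-trivial. A subdirectly
  irreducible kite therefore has a connected graph (\<open>kite_si_connected\<close>).

  Every vertex of the graph has at most one outgoing and at most one incoming edge, so a connected
  infinite graph of this kind is a two-way infinite path, a path without a beginning that ends in a
  point outside \<open>I1\<close>, or a path without an end that starts in a point outside \<open>l ` I1\<close>
  (\<open>permutation_bij\<close>, \<open>sink_bij\<close>, \<open>source_bij\<close>). These are the graphs of the three model kites, and
  relabelling the indices is an isomorphism of kites (\<open>kite_relabel\<close>).

  No two of the models are isomorphic, because a kite remembers whether \<open>I1 = I0\<close> and whether
  \<open>l ` I1 = I0\<close>. Multiplying by the unit of layer 1 on the left restricts a sequence to \<open>I1\<close>;
  multiplying by it on the right composes the sequence with \<open>l\<close>. So the first map is injective iff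
  \<open>I1 = I0\<close>, the second iff \<open>l ` I1 = I0\<close>. To express this without
  mentioning layers, note that this unit is comparable to everything and not idempotent, and that no
  element of layer 0 has both properties. Cancellation against all elements with these two properties
  at once is an isomorphism invariant that does the same job (\<open>pivots_left_cancel_iff\<close>, \<open>pivots_right_cancel_iff\<close>).
\<close>

section \<open>Residuated lattices\<close>

context residuated_lattice
begin

lemma le_antisym:
  "\<lbrakk>x \<in> carrier G; y \<in> carrier G; rl_le G x y; rl_le G y x\<rbrakk> \<Longrightarrow> x = y"
  unfolding rl_le_def using meet_comm by metis

lemma ldiv_unique:
  assumes "x \<in> carrier G" "z \<in> carrier G" "u \<in> carrier G"
    and "\<And>w. w \<in> carrier G \<Longrightarrow> rl_le G w u \<longleftrightarrow> rl_le G (x \<otimes> w) z"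
  shows "u = rl_ldiv G x z"
  proof (rule le_antisym)
  have key: "rl_le G w u \<longleftrightarrow> rl_le G w (rl_ldiv G x z)" if "w \<in> carrier G" for w
    using assms that by (simp add: residual_left)
  show "rl_le G u (rl_ldiv G x z)" "rl_le G (rl_ldiv G x z) u"
    using key assms(1-3) le_refl ldiv_closed by blast+
qed (use assms in \<open>simp_all add: ldiv_closed\<close>)

lemma rdiv_unique:
  assumes "y \<in> carrier G" "z \<in> carrier G" "u \<in> carrier G"
    and "\<And>w. w \<in> carrier G \<Longrightarrow> rl_le G w u \<longleftrightarrow> rl_le G (w \<otimes> y) z"
  shows "u = rl_rdiv G z y"
  proof (rule le_antisym)
  have key: "rl_le G w u \<longleftrightarrow> rl_le G w (rl_rdiv G z y)" if "w \<in> carrier G" for w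
    using assms that by (simp add: residual_right)
  show "rl_le G u (rl_rdiv G z y)" "rl_le G (rl_rdiv G z y) u"
    using key assms(1-3) le_refl rdiv_closed by blast+
qed (use assms in \<open>simp_all add: rdiv_closed\<close>)

end

text \<open>
  The residuals are determined by the order and the product, so they need not be checked when an
  isomorphism is constructed.
\<close>

lemma rl_isomorphicI:
  assumes "residuated_lattice A" "residuated_lattice B"
    and iso: "h \<in> iso A B"
    and meet: "\<And>x y. \<lbrakk>x \<in> carrier A; y \<in> carrier A\<rbrakk> \<Longrightarrow> h (rl_meet A x y) = rl_meet B (h x) (h y)"
    and join: "\<And>x y. \<lbrakk>x \<in> carrier A; y \<in> carrier A\<rbrakk> \<Longrightarrow> h (rl_join A x y) = rl_join B (h x) (h y)"
  shows "rl_isomorphic A B"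
proof -
  interpret A: residuated_lattice A by fact
  interpret B: residuated_lattice B by fact
  have closed: "h x \<in> carrier B" if "x \<in> carrier A" for x
    using iso that by (auto simp: iso_def hom_def)
  have mult: "h (x \<otimes>\<^bsub>A\<^esub> y) = h x \<otimes>\<^bsub>B\<^esub> h y" if "x \<in> carrier A" "y \<in> carrier A" for x y
    using iso that by (auto simp: iso_def hom_def)
  have inj: "inj_on h (carrier A)" and onto: "h ` carrier A = carrier B"
    using iso by (auto simp: iso_def bij_betw_def)
  have le: "rl_le B (h x) (h y) \<longleftrightarrow> rl_le A x y" if "x \<in> carrier A" "y \<in> carrier A" for x y
    using that inj by (simp add: rl_le_def meet[symmetric] A.meet_closed inj_on_eq_iff)
  have "h \<one>\<^bsub>A\<^esub> = \<one>\<^bsub>B\<^esub>"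
  proof (rule B.one_unique)
    fix y assume "y \<in> carrier B"
    then obtain x where "x \<in> carrier A" "y = h x" using onto by blast
    then show "h \<one>\<^bsub>A\<^esub> \<otimes>\<^bsub>B\<^esub> y = y" by (simp flip: mult)
  qed (simp add: closed)
  moreover have "h (rl_ldiv A x z) = rl_ldiv B (h x) (h z)"
    if "x \<in> carrier A" "z \<in> carrier A" for x z
  proof (rule B.ldiv_unique)
    fix w assume "w \<in> carrier B"
    then obtain v where v: "v \<in> carrier A" "w = h v" using onto by blast
    then show "rl_le B w (h (rl_ldiv A x z)) \<longleftrightarrow> rl_le B (h x \<otimes>\<^bsub>B\<^esub> w) (h z)"
      using that by (simp add: le A.ldiv_closed A.residual_left flip: mult)
  qed (use that in \<open>simp_all add: closed A.ldiv_closed\<close>)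
  moreover have "h (rl_rdiv A z y) = rl_rdiv B (h z) (h y)"
    if "y \<in> carrier A" "z \<in> carrier A" for y z
  proof (rule B.rdiv_unique)
    fix w assume "w \<in> carrier B"
    then obtain v where v: "v \<in> carrier A" "w = h v" using onto by blast
    then show "rl_le B w (h (rl_rdiv A z y)) \<longleftrightarrow> rl_le B (w \<otimes>\<^bsub>B\<^esub> h y) (h z)"
      using that by (simp add: le A.rdiv_closed A.residual_right flip: mult)
  qed (use that in \<open>simp_all add: closed A.rdiv_closed\<close>)
  ultimately show ?thesis
    unfolding rl_isomorphic_def by (intro bexI[OF _ iso]) (simp add: meet join)
qed


section \<open>Two isomorphism invariants\<close>

text \<open>
  In a kite with at least two indices over a non-trivial \<open>G\<close>, these elements include the unit of
  layer 1 but nothing in layer 0. The second condition excludes the unit of the kite and, if \<open>G\<close> is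
  bounded, the least element of layer 0: both are comparable to everything.
\<close>

definition pivots :: "('a, 'm) res_lattice_scheme \<Rightarrow> 'a set" where
  "pivots K = {z \<in> carrier K. (\<forall>w \<in> carrier K. rl_le K z w \<or> rl_le K w z) \<and> z \<otimes>\<^bsub>K\<^esub> z \<noteq> z}"

definition pivots_left_cancel :: "('a, 'm) res_lattice_scheme \<Rightarrow> bool" where
  "pivots_left_cancel K \<longleftrightarrow> (\<forall>x \<in> carrier K. \<forall>y \<in> carrier K.
     (\<forall>z \<in> pivots K. z \<otimes>\<^bsub>K\<^esub> x = z \<otimes>\<^bsub>K\<^esub> y) \<longrightarrow> x = y)"

definition pivots_right_cancel :: "('a, 'm) res_lattice_scheme \<Rightarrow> bool" where
  "pivots_right_cancel K \<longleftrightarrow> (\<forall>x \<in> carrier K. \<forall>y \<in> carrier K.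
     (\<forall>z \<in> pivots K. x \<otimes>\<^bsub>K\<^esub> z = y \<otimes>\<^bsub>K\<^esub> z) \<longrightarrow> x = y)"

lemma pivots_cancel_isomorphic:
  assumes "residuated_lattice A" "rl_isomorphic A B"
  shows "pivots_left_cancel A \<longleftrightarrow> pivots_left_cancel B"
    and "pivots_right_cancel A \<longleftrightarrow> pivots_right_cancel B"
proof -
  interpret A: residuated_lattice A by fact
  obtain h where iso: "h \<in> iso A B"
    and meet: "\<And>x y. \<lbrakk>x \<in> carrier A; y \<in> carrier A\<rbrakk> \<Longrightarrow> h (rl_meet A x y) = rl_meet B (h x) (h y)"
    using assms(2) unfolding rl_isomorphic_def by blast
  have mult: "h x \<otimes>\<^bsub>B\<^esub> h y = h (x \<otimes>\<^bsub>A\<^esub> y)" if "x \<in> carrier A" "y \<in> carrier A" for x y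
    using iso that by (auto simp: iso_def hom_def)
  have inj: "inj_on h (carrier A)" and onto: "carrier B = h ` carrier A"
    using iso by (auto simp: iso_def bij_betw_def)
  have eq: "h x = h y \<longleftrightarrow> x = y" if "x \<in> carrier A" "y \<in> carrier A" for x y
    using that inj by (simp add: inj_on_eq_iff)
  have le: "rl_le B (h x) (h y) \<longleftrightarrow> rl_le A x y" if "x \<in> carrier A" "y \<in> carrier A" for x y
    using that by (simp add: rl_le_def eq A.meet_closed flip: meet)
  have piv: "h z \<in> pivots B \<longleftrightarrow> z \<in> pivots A" if "z \<in> carrier A" for z
    using that by (auto simp: pivots_def onto le mult eq)
  have all: "(\<forall>z \<in> pivots B. P z) \<longleftrightarrow> (\<forall>z \<in> pivots A. P (h z))" for P
  proof -
    have "pivots A \<subseteq> carrier A" "pivots B \<subseteq> h ` carrier A"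
      by (auto simp: pivots_def onto)
    then show ?thesis using piv by blast
  qed
  have sub: "z \<in> carrier A" if "z \<in> pivots A" for z using that by (simp add: pivots_def)
  show "pivots_left_cancel A \<longleftrightarrow> pivots_left_cancel B"
    by (simp add: pivots_left_cancel_def onto all mult eq sub cong: ball_cong)
  show "pivots_right_cancel A \<longleftrightarrow> pivots_right_cancel B"
    by (simp add: pivots_right_cancel_def onto all mult eq sub cong: ball_cong)
qed


section \<open>The operations of a kite\<close>

context
  fixes I0 I1 :: "'i set" and l :: "'i \<Rightarrow> 'i" and G :: "('a, 'm) res_lattice_scheme"
begin

lemma carrier_kite: "carrier (kite I0 I1 l G) = (SIGMA n:UNIV. kite_index I0 I1 l n \<rightarrow>\<^sub>E carrier G)"
  by (simp add: kite_def kite_carrier_def Let_def)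

lemma mult_kite:
  "(m, x) \<otimes>\<^bsub>kite I0 I1 l G\<^esub> (n, y) =
    (m + n, \<lambda>i \<in> kite_index I0 I1 l (m + n). x ((l ^^ n) i) \<otimes>\<^bsub>G\<^esub> y i)"
  by (simp add: kite_def Let_def)

lemma meet_kite:
  "rl_meet (kite I0 I1 l G) (m, x) (n, y) =
    (if m < n then (n, y) else if n < m then (m, x)
     else (m, \<lambda>i \<in> kite_index I0 I1 l m. rl_meet G (x i) (y i)))"
  by (simp add: kite_def Let_def)

lemma join_kite:
  "rl_join (kite I0 I1 l G) (m, x) (n, y) =
    (if m < n then (m, x) else if n < m then (n, y)
     else (m, \<lambda>i \<in> kite_index I0 I1 l m. rl_join G (x i) (y i)))"
  by (simp add: kite_def Let_def)

lemma ldiv_kite: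
  "rl_ldiv (kite I0 I1 l G) (n, y) (m, x) =
    (if n > m then (0, \<lambda>i \<in> I0. \<one>\<^bsub>G\<^esub>)
     else (m - n, \<lambda>i \<in> kite_index I0 I1 l (m - n).
       if i \<in> kite_index I0 I1 l m then rl_ldiv G (y ((l ^^ (m - n)) i)) (x i) else \<one>\<^bsub>G\<^esub>))"
  by (simp add: kite_def Let_def)

lemma rdiv_kite:
  "rl_rdiv (kite I0 I1 l G) (n, y) (m, x) =
    (if m > n then (0, \<lambda>i \<in> I0. \<one>\<^bsub>G\<^esub>)
     else (n - m, \<lambda>i \<in> kite_index I0 I1 l (n - m).
       if i \<in> (l ^^ m) ` kite_index I0 I1 l n
       then rl_rdiv G (y (inv_into (kite_index I0 I1 l m) (l ^^ m) i))
                      (x (inv_into (kite_index I0 I1 l m) (l ^^ m) i))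
       else \<one>\<^bsub>G\<^esub>))"
  by (simp add: kite_def Let_def)

lemma le_kite:
  assumes "(n, x) \<in> carrier (kite I0 I1 l G)" "(m, y) \<in> carrier (kite I0 I1 l G)"
  shows "rl_le (kite I0 I1 l G) (n, x) (m, y) \<longleftrightarrow>
    m < n \<or> m = n \<and> (\<forall>i \<in> kite_index I0 I1 l n. rl_le G (x i) (y i))"
  using rl_le_kite[OF assms] by (simp add: kite_le_def)

end

locale kite_frame =
  fixes I0 I1 :: "'i set" and l :: "'i \<Rightarrow> 'i"
  assumes subset: "I1 \<subseteq> I0" and maps: "l \<in> I1 \<rightarrow> I0" and inj: "inj_on l I1"
begin

abbreviation I where "I \<equiv> kite_index I0 I1 l"

lemma index_antimono: "m \<le> n \<Longrightarrow> I n \<subseteq> I m"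
  using kite_index_antimono[OF subset] .

lemma index_subset: "I n \<subseteq> I0"
  using index_antimono[of 0 n] by simp

lemma index_Suc_iff: "i \<in> I (Suc n) \<longleftrightarrow> i \<in> I1 \<and> l i \<in> I n"
  using kite_index_iff[OF subset maps, of i n 1] by simp

lemma index_total: "I1 = I0 \<Longrightarrow> I n = I0"
proof (induction n)
  case (Suc n)
  then have "i \<in> I (Suc n) \<longleftrightarrow> i \<in> I0" for i
    using index_Suc_iff[of i n] maps by auto
  then show ?case by blast
qed simp

end

locale kite_base = kite_frame I0 I1 l + G: integral_residuated_lattice G
  for I0 I1 :: "'i set" and l :: "'i \<Rightarrow> 'i" and G :: "('a, 'm) res_lattice_scheme"
begin

abbreviation K where "K \<equiv> kite I0 I1 l G"

sublocale K: integral_residuated_lattice K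
  using kite_integral_residuated_lattice[OF G.integral_residuated_lattice_axioms subset maps inj] .

end


section \<open>Subdirect irreducibility forces connectedness\<close>

text \<open>
  The kernel of forgetting the coordinates outside \<open>B\<close> while keeping the layer; a congruence when
  \<open>B\<close> is a union of components.
\<close>

definition kite_agree ::
  "'i set \<Rightarrow> 'i set \<Rightarrow> ('i \<Rightarrow> 'i) \<Rightarrow> ('a, 'm) res_lattice_scheme \<Rightarrow> 'i set
    \<Rightarrow> ((nat \<times> ('i \<Rightarrow> 'a)) \<times> (nat \<times> ('i \<Rightarrow> 'a))) set" where
  "kite_agree I0 I1 l G B = {(p, q). p \<in> carrier (kite I0 I1 l G) \<and> q \<in> carrier (kite I0 I1 l G) \<and>
     fst p = fst q \<and> (\<forall>i \<in> kite_index I0 I1 l (fst p) \<inter> B. snd p i = snd q i)}"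

context kite_base
begin

text \<open>
  Coordinate \<open>i\<close> of a product or a residual depends only on coordinates of the form \<open>(l ^^ n) i\<close> or
  \<open>l\<^sup>-\<^sup>n i\<close> of the arguments, and an invariant set contains \<open>i\<close> iff it contains these.
\<close>

lemma kite_agree_congruence:
  assumes invariant: "\<And>i. i \<in> I1 \<Longrightarrow> l i \<in> B \<longleftrightarrow> i \<in> B"
  shows "rl_congruence K (kite_agree I0 I1 l G B)"
proof -
  have pow: "(l ^^ n) i \<in> I m \<inter> B" if "i \<in> I (m + n)" "i \<in> B" for m n i
    using that
  proof (induction n arbitrary: i)
    case (Suc n)
    then have "i \<in> I1" "l i \<in> I (m + n)" by (simp_all add: index_Suc_iff)
    then show ?case using Suc invariant by (simp add: funpow_swap1)
  qed simp
  have pow': "i \<in> B" if "i \<in> I n" "(l ^^ n) i \<in> B" for n i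
    using that
  proof (induction n arbitrary: i)
    case (Suc n)
    then have "i \<in> I1" "l i \<in> I n" "(l ^^ n) (l i) \<in> B"
      by (simp_all add: index_Suc_iff funpow_swap1)
    then show ?case using Suc.IH invariant by blast
  qed simp
  have inv: "inv_into (I m) (l ^^ m) ((l ^^ m) i) = i" if "i \<in> I n" "m \<le> n" for i m n
    using that inj_on_kite_index[OF subset maps inj] index_antimono by (meson inv_into_f_f subsetD)
  have "equiv (carrier K) (kite_agree I0 I1 l G B)"
    by (rule equivI) (auto simp: kite_agree_def refl_on_def sym_def trans_def)
  moreover have "(p \<otimes>\<^bsub>K\<^esub> q, p' \<otimes>\<^bsub>K\<^esub> q') \<in> kite_agree I0 I1 l G B \<and>
        (rl_meet K p q, rl_meet K p' q') \<in> kite_agree I0 I1 l G B \<and>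
        (rl_join K p q, rl_join K p' q') \<in> kite_agree I0 I1 l G B \<and>
        (rl_ldiv K p q, rl_ldiv K p' q') \<in> kite_agree I0 I1 l G B \<and>
        (rl_rdiv K p q, rl_rdiv K p' q') \<in> kite_agree I0 I1 l G B"
    if p: "(p, p') \<in> kite_agree I0 I1 l G B" and q: "(q, q') \<in> kite_agree I0 I1 l G B" for p p' q q'
  proof -
    obtain m x x' where px: "p = (m, x)" "p' = (m, x')"
      using p by (cases p, cases p') (auto simp: kite_agree_def)
    obtain n y y' where qy: "q = (n, y)" "q' = (n, y')"
      using q by (cases q, cases q') (auto simp: kite_agree_def)
    have carr: "p \<in> carrier K" "p' \<in> carrier K" "q \<in> carrier K" "q' \<in> carrier K"
      using p q by (auto simp: kite_agree_def)
    have x: "x i = x' i" if "i \<in> I m" "i \<in> B" for i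
      using p that by (auto simp: kite_agree_def px)
    have y: "y i = y' i" if "i \<in> I n" "i \<in> B" for i
      using q that by (auto simp: kite_agree_def qy)
    have "fst (p \<otimes>\<^bsub>K\<^esub> q) = fst (p' \<otimes>\<^bsub>K\<^esub> q') \<and>
        (\<forall>i \<in> I (fst (p \<otimes>\<^bsub>K\<^esub> q)) \<inter> B. snd (p \<otimes>\<^bsub>K\<^esub> q) i = snd (p' \<otimes>\<^bsub>K\<^esub> q') i)"
      using x y pow index_antimono[of n "m + n"] by (auto simp: px qy mult_kite)
    moreover have "fst (rl_meet K p q) = fst (rl_meet K p' q') \<and>
        (\<forall>i \<in> I (fst (rl_meet K p q)) \<inter> B. snd (rl_meet K p q) i = snd (rl_meet K p' q') i)"
      using x y by (auto simp: px qy meet_kite)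
    moreover have "fst (rl_join K p q) = fst (rl_join K p' q') \<and>
        (\<forall>i \<in> I (fst (rl_join K p q)) \<inter> B. snd (rl_join K p q) i = snd (rl_join K p' q') i)"
      using x y by (auto simp: px qy join_kite)
    moreover have "fst (rl_ldiv K p q) = fst (rl_ldiv K p' q') \<and>
        (\<forall>i \<in> I (fst (rl_ldiv K p q)) \<inter> B. snd (rl_ldiv K p q) i = snd (rl_ldiv K p' q') i)"
    proof (cases "m \<le> n")
      case True
      then have "x ((l ^^ (n - m)) i) = x' ((l ^^ (n - m)) i)" if "i \<in> I n" "i \<in> B" for i
        using x pow[of i m "n - m"] that by simp
      then show ?thesis using y True by (auto simp: px qy ldiv_kite)
    qed (simp add: px qy ldiv_kite)
    moreover have "fst (rl_rdiv K p q) = fst (rl_rdiv K p' q') \<and>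
        (\<forall>i \<in> I (fst (rl_rdiv K p q)) \<inter> B. snd (rl_rdiv K p q) i = snd (rl_rdiv K p' q') i)"
    proof (cases "n \<le> m")
      case True
      have "x i = x' i \<and> y i = y' i" if "i \<in> I m" "(l ^^ n) i \<in> B" for i
        using x y pow' that index_antimono[OF True] by blast
      then show ?thesis using True by (auto simp: px qy rdiv_kite inv)
    qed (simp add: px qy rdiv_kite)
    ultimately show ?thesis
      using carr by (simp add: kite_agree_def K.meet_closed K.join_closed K.ldiv_closed K.rdiv_closed)
  qed
  ultimately show ?thesis
    unfolding rl_congruence_def by blast
qed

lemma kite_agree_nontrivial:
  assumes "rl_nontrivial G" "i \<in> I0" "i \<notin> B"
  shows "kite_agree I0 I1 l G B \<noteq> Id_on (carrier K)"
proof -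
  obtain g where g: "g \<in> carrier G" "g \<noteq> \<one>\<^bsub>G\<^esub>"
    using assms(1) by (auto simp: rl_nontrivial_def)
  let ?u = "\<lambda>i \<in> I0. \<one>\<^bsub>G\<^esub>"
  have "((0, ?u), (0, ?u(i := g))) \<in> kite_agree I0 I1 l G B"
    using assms(2,3) g by (auto simp: kite_agree_def carrier_kite PiE_iff extensional_def)
  moreover have "((0, ?u), (0, ?u(i := g))) \<notin> Id_on (carrier K)"
    using assms(2) g by (auto dest!: fun_cong[where x = i])
  ultimately show ?thesis by metis
qed

text \<open>
  Otherwise the congruences for \<open>A\<close> and for its complement are both above the least non-identity
  congruence, yet they meet in the identity.
\<close>

lemma kite_si_connected:
  assumes "rl_nontrivial G" "subdirectly_irreducible K"
    and "A \<subseteq> I0" "A \<noteq> {}"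
    and invariant: "\<And>i. i \<in> I1 \<Longrightarrow> l i \<in> A \<longleftrightarrow> i \<in> A"
  shows "A = I0"
proof (rule ccontr)
  assume "A \<noteq> I0"
  then obtain i j where ij: "i \<in> I0" "i \<in> A" "j \<in> I0" "j \<notin> A" using assms(3,4) by blast
  obtain \<theta> where \<theta>: "rl_congruence K \<theta>" "\<theta> \<noteq> Id_on (carrier K)"
    and least: "\<And>\<phi>. \<lbrakk>rl_congruence K \<phi>; \<phi> \<noteq> Id_on (carrier K)\<rbrakk> \<Longrightarrow> \<theta> \<subseteq> \<phi>"
    using assms(2) unfolding subdirectly_irreducible_def by blast
  have "\<theta> \<subseteq> kite_agree I0 I1 l G A"
    using kite_agree_congruence[of A] kite_agree_nontrivial[of j A] assms(1) invariant ij least by blast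
  moreover have "\<theta> \<subseteq> kite_agree I0 I1 l G (- A)"
    using kite_agree_congruence[of "- A"] kite_agree_nontrivial[of i "- A"] assms(1) invariant ij least
    by blast
  moreover have "p = q"
    if agree: "(p, q) \<in> kite_agree I0 I1 l G A" "(p, q) \<in> kite_agree I0 I1 l G (- A)" for p q
  proof -
    obtain n x y where pq: "p = (n, x)" "q = (n, y)"
      using agree by (cases p, cases q) (auto simp: kite_agree_def)
    have "x \<in> I n \<rightarrow>\<^sub>E carrier G" "y \<in> I n \<rightarrow>\<^sub>E carrier G" "\<forall>i \<in> I n. x i = y i"
      using agree by (auto simp: pq kite_agree_def carrier_kite)
    then show ?thesis by (auto simp: pq intro: PiE_ext)
  qed
  ultimately have "p = q" if "(p, q) \<in> \<theta>" for p q using that by blast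
  then have "\<theta> \<subseteq> Id" by auto
  moreover have "equiv (carrier K) \<theta>"
    using \<theta>(1) by (simp add: rl_congruence_def)
  ultimately have "\<theta> = Id_on (carrier K)"
    by (auto simp: equiv_def refl_on_def)
  then show False using \<theta>(2) by contradiction
qed

end


section \<open>Reading off the partial injection from the kite\<close>

context kite_base
begin

lemma layer_one_unit_in_pivots: "(1, \<lambda>i \<in> I1. \<one>\<^bsub>G\<^esub>) \<in> pivots K"
proof -
  have c: "(1, \<lambda>i \<in> I1. \<one>\<^bsub>G\<^esub>) \<in> carrier K" by (auto simp: carrier_kite)
  have "rl_le K (1, \<lambda>i \<in> I1. \<one>\<^bsub>G\<^esub>) w \<or> rl_le K w (1, \<lambda>i \<in> I1. \<one>\<^bsub>G\<^esub>)"
    if w: "w \<in> carrier K" for w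
  proof -
    obtain n x where wx: "w = (n, x)" by (metis surj_pair)
    then have x: "x i \<in> carrier G" if "i \<in> I n" for i using w that by (auto simp: carrier_kite)
    consider "n < 1" | "n = 1" | "1 < n" by linarith
    then show ?thesis
      using w c x unfolding wx by cases (auto simp: le_kite G.integral)
  qed
  then show ?thesis using c by (auto simp: pivots_def mult_kite)
qed

text \<open>
  Let \<open>z\<close> in layer 0 be comparable to everything and let \<open>z i\<close> not be idempotent, so \<open>z i\<close> is not the
  unit. A sequence that is the unit everywhere except at some \<open>j \<noteq> i\<close> cannot lie below \<open>z\<close>, so it lies
  above; as its value at \<open>j\<close> is arbitrary, \<open>z j\<close> is the least element of \<open>G\<close>, in particular not the
  unit. Exchanging \<open>i\<close> and \<open>j\<close>, also \<open>z i\<close> is least, and a least element is idempotent.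
\<close>

lemma pivots_layer:
  assumes "rl_nontrivial G" "i0 \<in> I0" "i1 \<in> I0" "i0 \<noteq> i1" "(n, z) \<in> pivots K"
  shows "n \<noteq> 0"
proof
  assume n: "n = 0"
  obtain g where g: "g \<in> carrier G" "g \<noteq> \<one>\<^bsub>G\<^esub>"
    using assms(1) by (auto simp: rl_nontrivial_def)
  have zK: "(0, z) \<in> carrier K" using assms(5) n by (simp add: pivots_def)
  then have z: "z \<in> I0 \<rightarrow>\<^sub>E carrier G" by (simp add: carrier_kite)
  have nle: "\<not> rl_le G \<one>\<^bsub>G\<^esub> a" if "a \<in> carrier G" "a \<noteq> \<one>\<^bsub>G\<^esub>" for a
    using that G.integral G.le_antisym by blast
  have below: "rl_le G (z j) a"
    if "i \<in> I0" "z i \<noteq> \<one>\<^bsub>G\<^esub>" "j \<in> I0" "j \<noteq> i" "a \<in> carrier G" for i j a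
  proof -
    let ?w = "\<lambda>k \<in> I0. if k = j then a else \<one>\<^bsub>G\<^esub>"
    have w: "(0, ?w) \<in> carrier K" using that by (auto simp: carrier_kite)
    have "rl_le K (0, z) (0, ?w) \<or> rl_le K (0, ?w) (0, z)"
      using assms(5) n w by (auto simp: pivots_def)
    moreover have "\<not> rl_le G (?w i) (z i)" using that z nle by auto
    ultimately have "\<forall>k \<in> I0. rl_le G (z k) (?w k)"
      using le_kite[OF zK w] le_kite[OF w zK] that(1) by auto
    then have "rl_le G (z j) (?w j)" using that by blast
    then show ?thesis using that by simp
  qed
  have "(0, z) \<otimes>\<^bsub>K\<^esub> (0, z) \<noteq> (0, z)" using assms(5) n by (simp add: pivots_def)
  then have "(\<lambda>i \<in> I0. z i \<otimes>\<^bsub>G\<^esub> z i) \<noteq> z" by (simp add: mult_kite)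
  then obtain i where i: "i \<in> I0" "z i \<otimes>\<^bsub>G\<^esub> z i \<noteq> z i"
    using z by (metis (no_types, lifting) PiE_arb restrict_apply ext)
  have zc: "z k \<in> carrier G" if "k \<in> I0" for k using z that by auto
  have zi: "z i \<noteq> \<one>\<^bsub>G\<^esub>" using i by auto
  obtain j where j: "j \<in> I0" "j \<noteq> i" using assms(2-4) by metis
  \<comment> \<open>Another non-unit coordinate would make \<open>z i\<close> least in \<open>G\<close>, hence idempotent by integrality.\<close>
  have "z j = \<one>\<^bsub>G\<^esub>"
  proof (rule ccontr)
    assume "z j \<noteq> \<one>\<^bsub>G\<^esub>"
    then have least: "rl_le G (z i) a" if "a \<in> carrier G" for a using below[of j i] that i j by blast
    have "rl_le G (z i) (rl_rdiv G (z i) (z i))" using least zc i by (simp add: G.rdiv_closed)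
    then have "rl_le G (z i \<otimes>\<^bsub>G\<^esub> z i) (z i)" using G.residual_right zc i by simp
    then show False using least[of "z i \<otimes>\<^bsub>G\<^esub> z i"] G.le_antisym zc i by simp
  qed
  then show False using below[OF i(1) zi j, OF g(1)] nle g by simp
qed

text \<open>
  Right multiplication by the unit of layer 1 sends \<open>x\<close> to \<open>x \<circ> l\<close>, which determines \<open>x\<close> if \<open>l\<close> is onto.
  A factor from layer \<open>n > 0\<close> composes \<open>x\<close> with \<open>l ^^ n\<close>, so the product never sees a coordinate
  outside the image of \<open>l\<close>.
\<close>

lemma pivots_right_cancel_iff:
  assumes "rl_nontrivial G" "i0 \<in> I0" "i1 \<in> I0" "i0 \<noteq> i1"
  shows "pivots_right_cancel K \<longleftrightarrow> l ` I1 = I0"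
proof
  assume onto: "l ` I1 = I0"
  show "pivots_right_cancel K"
    unfolding pivots_right_cancel_def
  proof (intro ballI impI)
    fix p q assume p: "p \<in> carrier K" and q: "q \<in> carrier K"
      and eq: "\<forall>z \<in> pivots K. p \<otimes>\<^bsub>K\<^esub> z = q \<otimes>\<^bsub>K\<^esub> z"
    obtain m x n y where xy: "p = (m, x)" "q = (n, y)" by (metis surj_pair)
    have "p \<otimes>\<^bsub>K\<^esub> (1, \<lambda>i \<in> I1. \<one>\<^bsub>G\<^esub>) = q \<otimes>\<^bsub>K\<^esub> (1, \<lambda>i \<in> I1. \<one>\<^bsub>G\<^esub>)"
      using eq layer_one_unit_in_pivots by blast
    then have mn: "m = n" and coords: "(\<lambda>i \<in> I (Suc m). x (l i) \<otimes>\<^bsub>G\<^esub> (\<lambda>i \<in> I1. \<one>\<^bsub>G\<^esub>) i)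
        = (\<lambda>i \<in> I (Suc n). y (l i) \<otimes>\<^bsub>G\<^esub> (\<lambda>i \<in> I1. \<one>\<^bsub>G\<^esub>) i)"
      by (auto simp: xy mult_kite)
    have x: "x \<in> I m \<rightarrow>\<^sub>E carrier G" and y: "y \<in> I m \<rightarrow>\<^sub>E carrier G"
      using p q by (auto simp: xy mn carrier_kite)
    have "x j = y j" if j: "j \<in> I m" for j
    proof -
      obtain i where i: "i \<in> I1" "j = l i" using j index_subset onto by blast
      then have "i \<in> I (Suc m)" using j by (simp add: index_Suc_iff)
      then have "x (l i) \<otimes>\<^bsub>G\<^esub> \<one>\<^bsub>G\<^esub> = y (l i) \<otimes>\<^bsub>G\<^esub> \<one>\<^bsub>G\<^esub>"
        using fun_cong[OF coords, of i] i mn by simp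
      moreover have "x (l i) \<in> carrier G" "y (l i) \<in> carrier G" using x y j i by auto
      ultimately show ?thesis using i by simp
    qed
    then show "p = q" using x y by (auto simp: xy mn intro: PiE_ext)
  qed
next
  assume cancel: "pivots_right_cancel K"
  show "l ` I1 = I0"
  proof (rule ccontr)
    assume "l ` I1 \<noteq> I0"
    then obtain j where j: "j \<in> I0" "j \<notin> l ` I1" using maps by blast
    obtain g where g: "g \<in> carrier G" "g \<noteq> \<one>\<^bsub>G\<^esub>"
      using assms(1) by (auto simp: rl_nontrivial_def)
    let ?u = "\<lambda>i \<in> I0. \<one>\<^bsub>G\<^esub>"
    have c: "(0, ?u) \<in> carrier K" "(0, ?u(j := g)) \<in> carrier K"
      using j g by (auto simp: carrier_kite PiE_iff extensional_def)
    have "(0, ?u) \<otimes>\<^bsub>K\<^esub> z = (0, ?u(j := g)) \<otimes>\<^bsub>K\<^esub> z" if z: "z \<in> pivots K" for z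
    proof -
      obtain n x where nx: "z = (n, x)" by (metis surj_pair)
      have "n \<noteq> 0" using pivots_layer[OF assms] z nx by blast
      then obtain k where k: "n = Suc k" by (cases n) auto
      have "(l ^^ n) i \<noteq> j" if "i \<in> I n" for i
        using kite_index_funpow[OF maps, of i 1 k] that j k by auto
      then show ?thesis by (auto simp: nx mult_kite intro!: restrict_ext)
    qed
    then have "(0::nat, ?u) = (0, ?u(j := g))"
      using cancel c unfolding pivots_right_cancel_def by blast
    then show False using j g by (auto dest!: fun_cong[where x = j])
  qed
qed

text \<open>
  Left multiplication by the unit of layer 1 restricts \<open>x\<close> to its indices in \<open>I1\<close>. A left factor from
  any layer \<open>n > 0\<close> forgets the coordinates outside \<open>I1\<close> too, because \<open>I n \<subseteq> I1\<close>.
\<close>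

lemma pivots_left_cancel_iff:
  assumes "rl_nontrivial G" "i0 \<in> I0" "i1 \<in> I0" "i0 \<noteq> i1"
  shows "pivots_left_cancel K \<longleftrightarrow> I1 = I0"
proof
  assume total: "I1 = I0"
  have idx: "kite_index I0 I0 l n = I0" for n using index_total[OF total] total by simp
  show "pivots_left_cancel K"
    unfolding pivots_left_cancel_def
  proof (intro ballI impI)
    fix p q assume p: "p \<in> carrier K" and q: "q \<in> carrier K"
      and eq: "\<forall>z \<in> pivots K. z \<otimes>\<^bsub>K\<^esub> p = z \<otimes>\<^bsub>K\<^esub> q"
    obtain m x n y where xy: "p = (m, x)" "q = (n, y)" by (metis surj_pair)
    have "(1, \<lambda>i \<in> I1. \<one>\<^bsub>G\<^esub>) \<otimes>\<^bsub>K\<^esub> p = (1, \<lambda>i \<in> I1. \<one>\<^bsub>G\<^esub>) \<otimes>\<^bsub>K\<^esub> q"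
      using eq layer_one_unit_in_pivots by blast
    then have mn: "m = n" and coords: "(\<lambda>i \<in> I0. (\<lambda>i \<in> I0. \<one>\<^bsub>G\<^esub>) ((l ^^ m) i) \<otimes>\<^bsub>G\<^esub> x i)
        = (\<lambda>i \<in> I0. (\<lambda>i \<in> I0. \<one>\<^bsub>G\<^esub>) ((l ^^ n) i) \<otimes>\<^bsub>G\<^esub> y i)"
      using idx by (auto simp: xy mult_kite total)
    have x: "x \<in> I0 \<rightarrow>\<^sub>E carrier G" and y: "y \<in> I0 \<rightarrow>\<^sub>E carrier G"
      using p q by (auto simp: xy carrier_kite index_total[OF total])
    have "x i = y i" if "i \<in> I0" for i
    proof -
      have "(l ^^ m) i \<in> I0"
        using kite_index_funpow[OF maps, of i 0 m] that index_total[OF total] by simp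
      then have "\<one>\<^bsub>G\<^esub> \<otimes>\<^bsub>G\<^esub> x i = \<one>\<^bsub>G\<^esub> \<otimes>\<^bsub>G\<^esub> y i"
        using fun_cong[OF coords, of i] that mn by simp
      moreover have "x i \<in> carrier G" "y i \<in> carrier G" using x y that by auto
      ultimately show ?thesis by simp
    qed
    then show "p = q" using x y by (auto simp: xy mn intro: PiE_ext)
  qed
next
  assume cancel: "pivots_left_cancel K"
  show "I1 = I0"
  proof (rule ccontr)
    assume "I1 \<noteq> I0"
    then obtain j where j: "j \<in> I0" "j \<notin> I1" using subset by blast
    obtain g where g: "g \<in> carrier G" "g \<noteq> \<one>\<^bsub>G\<^esub>"
      using assms(1) by (auto simp: rl_nontrivial_def)
    let ?u = "\<lambda>i \<in> I0. \<one>\<^bsub>G\<^esub>"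
    have c: "(0, ?u) \<in> carrier K" "(0, ?u(j := g)) \<in> carrier K"
      using j g by (auto simp: carrier_kite PiE_iff extensional_def)
    have "z \<otimes>\<^bsub>K\<^esub> (0, ?u) = z \<otimes>\<^bsub>K\<^esub> (0, ?u(j := g))" if z: "z \<in> pivots K" for z
    proof -
      obtain n x where nx: "z = (n, x)" by (metis surj_pair)
      have "n \<noteq> 0" using pivots_layer[OF assms] z nx by blast
      then have "j \<notin> I n" using index_antimono[of 1 n] j by auto
      then show ?thesis by (auto simp: nx mult_kite intro!: restrict_ext)
    qed
    then have "(0::nat, ?u) = (0, ?u(j := g))"
      using cancel c unfolding pivots_left_cancel_def by blast
    then show False using j g by (auto dest!: fun_cong[where x = j])
  qed
qed

end


section \<open>Relabelling the index sets\<close>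

text \<open>
  The map \<open>\<psi>\<close> goes from the new indices to the old ones, so that precomposition with it carries
  sequences over \<open>I0\<close> to sequences over \<open>J0\<close>.
\<close>

lemma kite_relabel:
  assumes "kite_base I0 I1 l G" "kite_frame J0 J1 m"
    and bij: "bij_betw \<psi> J0 I0"
    and dom: "\<And>j. j \<in> J0 \<Longrightarrow> \<psi> j \<in> I1 \<longleftrightarrow> j \<in> J1"
    and comm: "\<And>j. j \<in> J1 \<Longrightarrow> \<psi> (m j) = l (\<psi> j)"
  shows "rl_isomorphic (kite I0 I1 l G) (kite J0 J1 m G)"
proof -
  interpret A: kite_base I0 I1 l G by fact
  interpret B: kite_frame J0 J1 m by fact
  interpret B: kite_base J0 J1 m G by unfold_locales
  have index: "\<psi> j \<in> A.I n \<longleftrightarrow> j \<in> B.I n" if "j \<in> J0" for j n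
    using that
  proof (induction n arbitrary: j)
    case 0
    then show ?case using bij by (auto dest: bij_betwE)
  next
    case (Suc n)
    have "l (\<psi> j) \<in> A.I n \<longleftrightarrow> m j \<in> B.I n" if "j \<in> J1"
      using Suc.IH[of "m j"] comm[OF that] B.maps that by auto
    then show ?case
      using dom[OF Suc.prems] by (auto simp: A.index_Suc_iff B.index_Suc_iff)
  qed
  have image: "bij_betw \<psi> (B.I n) (A.I n)" for n
  proof (rule bij_betw_subset[OF bij B.index_subset])
    show "\<psi> ` B.I n = A.I n"
      using index B.index_subset A.index_subset bij_betw_imp_surj_on[OF bij] by blast
  qed
  have pow: "\<psi> ((m ^^ n) j) = (l ^^ n) (\<psi> j)" if "j \<in> B.I n" for j n
    using that comm by (induction n arbitrary: j) (auto simp: B.index_Suc_iff funpow_swap1)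
  have mem: "\<psi> j \<in> A.I n" if "j \<in> B.I n" for j n
    using index that B.index_subset by blast
  define h where "h = (\<lambda>(n, x). (n, \<lambda>j \<in> B.I n. x (\<psi> j)) :: nat \<times> (_ \<Rightarrow> 'b))"
  show ?thesis
  proof (rule rl_isomorphicI[of _ _ h])
    show "residuated_lattice A.K" "residuated_lattice B.K" by unfold_locales
    have "h p \<in> carrier B.K" if "p \<in> carrier A.K" for p
      using that mem by (cases p) (auto simp: h_def carrier_kite)
    moreover have "h (p \<otimes>\<^bsub>A.K\<^esub> q) = h p \<otimes>\<^bsub>B.K\<^esub> h q" for p q
    proof -
      obtain a x b y where [simp]: "p = (a, x)" "q = (b, y)" by (metis surj_pair)
      have "(m ^^ b) j \<in> B.I a" "j \<in> B.I b" if "j \<in> B.I (a + b)" for j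
        using kite_index_iff[OF B.subset B.maps] that by blast+
      then show ?thesis
        using mem pow by (auto simp: h_def mult_kite intro!: restrict_ext)
    qed
    moreover have "bij_betw h (carrier A.K) (carrier B.K)"
    proof (rule bij_betw_byWitness)
      define k where "k = (\<lambda>(n, y). (n, \<lambda>i \<in> A.I n. y (inv_into (B.I n) \<psi> i)) :: nat \<times> (_ \<Rightarrow> 'b))"
      have inv: "inv_into (B.I n) \<psi> (\<psi> j) = j" if "j \<in> B.I n" for j n
        using bij_betw_inv_into_left[OF image that] .
      have inv': "\<psi> (inv_into (B.I n) \<psi> i) = i" "inv_into (B.I n) \<psi> i \<in> B.I n" if "i \<in> A.I n" for i n
        using bij_betw_inv_into_right[OF image that] bij_betw_inv_into[OF image[of n]] that
        by (auto dest: bij_betwE)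
      show "\<forall>p \<in> carrier A.K. k (h p) = p"
      proof
        fix p assume p: "p \<in> carrier A.K"
        obtain n x where nx: "p = (n, x)" by (metis surj_pair)
        then have x: "x \<in> A.I n \<rightarrow>\<^sub>E carrier G" using p by (simp add: carrier_kite)
        have "(\<lambda>i \<in> A.I n. (\<lambda>j \<in> B.I n. x (\<psi> j)) (inv_into (B.I n) \<psi> i)) = x"
          using inv' by (intro ext) (simp add: PiE_arb[OF x])
        then show "k (h p) = p" by (simp add: h_def k_def nx)
      qed
      show "\<forall>q \<in> carrier B.K. h (k q) = q"
      proof
        fix q assume q: "q \<in> carrier B.K"
        obtain n y where ny: "q = (n, y)" by (metis surj_pair)
        then have y: "y \<in> B.I n \<rightarrow>\<^sub>E carrier G" using q by (simp add: carrier_kite)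
        have "(\<lambda>j \<in> B.I n. (\<lambda>i \<in> A.I n. y (inv_into (B.I n) \<psi> i)) (\<psi> j)) = y"
          using inv mem by (intro ext) (simp add: PiE_arb[OF y])
        then show "h (k q) = q" by (simp add: h_def k_def ny)
      qed
      show "h ` carrier A.K \<subseteq> carrier B.K"
        using mem by (auto simp: h_def carrier_kite)
      show "k ` carrier B.K \<subseteq> carrier A.K"
        using inv' by (auto simp: k_def carrier_kite)
    qed
    ultimately show "h \<in> iso A.K B.K" by (auto simp: iso_def hom_def)
    show "h (rl_meet A.K p q) = rl_meet B.K (h p) (h q)" for p q
      using mem by (cases p, cases q) (auto simp: h_def meet_kite intro!: restrict_ext)
    show "h (rl_join A.K p q) = rl_join B.K (h p) (h q)" for p q
      using mem by (cases p, cases q) (auto simp: h_def join_kite intro!: restrict_ext)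
  qed
qed


section \<open>Connected partial injections of an infinite set\<close>

text \<open>
  Two different iterates cannot agree: cancelling \<open>f\<close> would exhibit the starting point \<open>k\<close> as a value
  of \<open>f\<close>.
\<close>

lemma bij_betw_orbit:
  assumes f: "f \<in> S \<rightarrow> S" "inj_on f S" and k: "k \<in> S" "k \<notin> f ` S"
    and onto: "S \<subseteq> range (\<lambda>n. (f ^^ n) k)"
  shows "bij_betw (\<lambda>n. (f ^^ n) k) UNIV S"
proof -
  have mem: "(f ^^ n) k \<in> S" for n
    using f(1) k(1) by (induction n) auto
  have "a = b" if "(f ^^ a) k = (f ^^ b) k" for a b
    using that
  proof (induction a arbitrary: b)
    case 0
    then show ?case using k mem by (cases b) auto
  next
    case (Suc a)
    show ?case
    proof (cases b)
      case 0
      then have "k = f ((f ^^ a) k)" using Suc.prems by simp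
      then show ?thesis using k(2) mem by blast
    next
      case (Suc c)
      then have "(f ^^ a) k = (f ^^ c) k"
        using Suc.prems f(2) mem by (auto dest: inj_onD)
      then show ?thesis using Suc.IH Suc by simp
    qed
  qed
  then show ?thesis using mem onto by (auto simp: bij_betw_def inj_on_def)
qed

locale connected_frame = kite_frame I0 I1 l
  for I0 I1 :: "'i set" and l :: "'i \<Rightarrow> 'i" +
  assumes infinite_index: "infinite I0"
    and connected: "\<lbrakk>A \<subseteq> I0; A \<noteq> {}; \<And>i. i \<in> I1 \<Longrightarrow> l i \<in> A \<longleftrightarrow> i \<in> A\<rbrakk> \<Longrightarrow> A = I0"
begin

text \<open>
  The forward orbit of a point \<open>k\<close> without predecessor is closed under taking predecessors, as the
  predecessor of \<open>(l ^^ n) k\<close> is \<open>(l ^^ (n - 1)) k\<close>. So it is all of \<open>I0\<close> by connectedness.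
\<close>

lemma source_orbit:
  assumes k: "k \<in> I0" "k \<notin> l ` I1"
  shows "{(l ^^ n) k |n. k \<in> I n} = I0" (is "?A = _")
proof (rule connected)
  show "?A \<subseteq> I0" using kite_index_funpow[OF maps, of k 0] by auto
  show "?A \<noteq> {}" using k(1) by (auto intro!: exI[of _ 0])
  fix i assume i: "i \<in> I1"
  show "l i \<in> ?A \<longleftrightarrow> i \<in> ?A"
  proof
    assume "l i \<in> ?A"
    then obtain n where n: "l i = (l ^^ n) k" "k \<in> I n" by auto
    have "n \<noteq> 0" using n i k(2) by auto
    then obtain m where m: "n = Suc m" by (cases n) auto
    then have "(l ^^ m) k \<in> I1" using kite_index_funpow[OF maps, of k 1 m] n by simp
    then have "i = (l ^^ m) k" using n i m inj by (auto dest: inj_onD)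
    moreover have "k \<in> I m" using n m index_antimono[of m n] by auto
    ultimately show "i \<in> ?A" by blast
  next
    assume "i \<in> ?A"
    then obtain n where n: "i = (l ^^ n) k" "k \<in> I n" by auto
    then have "k \<in> I (1 + n)" using i kite_index_iff[OF subset maps, of k 1 n] by simp
    moreover have "l i = (l ^^ (1 + n)) k" using n by simp
    ultimately show "l i \<in> ?A" by blast
  qed
qed

text \<open>
  If the forward orbit of \<open>k\<close> reached a point outside \<open>I1\<close>, it would stop there, and \<open>I0\<close> would be a
  finite path.
\<close>

lemma source_total:
  assumes k: "k \<in> I0" "k \<notin> l ` I1"
  shows "I1 = I0"
proof (rule ccontr)
  assume "I1 \<noteq> I0"
  then obtain j where j: "j \<in> I0" "j \<notin> I1" using subset by blast
  then obtain n where n: "j = (l ^^ n) k" using source_orbit[OF k] by blast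
  have "m \<le> n" if "k \<in> I m" for m
  proof (rule ccontr)
    assume "\<not> m \<le> n"
    then have "k \<in> I (1 + n)" using index_antimono[of "1 + n" m] that by auto
    then show False using kite_index_funpow[OF maps, of k 1 n] n j by simp
  qed
  then have "{(l ^^ m) k |m. k \<in> I m} \<subseteq> (\<lambda>m. (l ^^ m) k) ` {..n}" by blast
  then have "I0 \<subseteq> (\<lambda>m. (l ^^ m) k) ` {..n}" using source_orbit[OF k] by blast
  then show False using infinite_index finite_surj by blast
qed

lemma source_bij:
  assumes k: "k \<in> I0" "k \<notin> l ` I1"
  shows "bij_betw (\<lambda>n. (l ^^ n) k) UNIV I0"
proof (rule bij_betw_orbit)
  show "I0 \<subseteq> range (\<lambda>n. (l ^^ n) k)" using source_orbit[OF k] by blast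
qed (use source_total[OF k] maps inj k in auto)

text \<open>
  The mirror image of \<open>source_bij\<close>: here the inverse of \<open>l\<close> is a total injection on \<open>I0\<close>, and \<open>j\<close> is
  not among its values.
\<close>

lemma sink_bij:
  assumes onto: "l ` I1 = I0" and j: "j \<in> I0" "j \<notin> I1"
  shows "bij_betw (\<lambda>n. (inv_into I1 l ^^ n) j) UNIV I0"
proof (rule bij_betw_orbit)
  let ?g = "inv_into I1 l"
  have g: "?g i \<in> I1" "l (?g i) = i" if "i \<in> I0" for i
    using that onto by (auto simp: inv_into_into f_inv_into_f)
  show "?g \<in> I0 \<rightarrow> I0" using g subset by auto
  show "inj_on ?g I0" using onto inj_on_inv_into by blast
  show "j \<in> I0" by fact
  show "j \<notin> ?g ` I0" using g j by auto
  have mem: "(?g ^^ n) j \<in> I0" for n using j g subset by (induction n) auto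
  have "range (\<lambda>n. (?g ^^ n) j) = I0" (is "?A = _")
  proof (rule connected)
    fix i assume i: "i \<in> I1"
    show "l i \<in> ?A \<longleftrightarrow> i \<in> ?A"
    proof
      assume "l i \<in> ?A"
      then obtain n where "l i = (?g ^^ n) j" by auto
      then have "i = (?g ^^ Suc n) j" using i inj by (metis funpow.simps(2) comp_apply inv_into_f_f)
      then show "i \<in> ?A" by blast
    next
      assume "i \<in> ?A"
      then obtain n where n: "i = (?g ^^ n) j" by auto
      then obtain m where "n = Suc m" using i j by (cases n) auto
      then have "l i = (?g ^^ m) j" using n g mem by simp
      then show "l i \<in> ?A" by blast
    qed
  qed (use mem in auto)
  then show "I0 \<subseteq> ?A" by simp
qed

text \<open>
  The two-way orbit of any point \<open>c\<close> is everything by connectedness. If two of its members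
  coincided, the orbit would be periodic, hence finite.
\<close>

lemma permutation_bij:
  assumes total: "I1 = I0" and onto: "l ` I1 = I0"
  obtains \<psi> :: "int \<Rightarrow> 'i" where "bij_betw \<psi> UNIV I0" "\<And>k. \<psi> (k + 1) = l (\<psi> k)"
proof -
  let ?g = "inv_into I0 l"
  have g: "?g i \<in> I0" "l (?g i) = i" if "i \<in> I0" for i
    using that onto total by (auto simp: inv_into_into f_inv_into_f)
  obtain c where c: "c \<in> I0" using infinite_index by (metis ex_in_conv finite.emptyI)
  define \<psi> :: "int \<Rightarrow> 'i" where
    "\<psi> k = (if k \<ge> 0 then (l ^^ nat k) c else (?g ^^ nat (- k)) c)" for k
  have gmem: "(?g ^^ n) c \<in> I0" for n using c g by (induction n) auto
  have "(l ^^ n) c \<in> I0" for n using c maps total by (induction n) auto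
  then have mem: "\<psi> k \<in> I0" for k using gmem by (simp add: \<psi>_def)
  have step: "\<psi> (k + 1) = l (\<psi> k)" for k
  proof (cases "k \<ge> 0")
    case True
    then show ?thesis by (simp add: \<psi>_def nat_add_distrib)
  next
    case False
    then obtain n where k: "k = - int (Suc n)" by (cases k) auto
    then have "\<psi> (k + 1) = (?g ^^ n) c" by (cases n) (simp_all add: \<psi>_def nat_add_distrib)
    moreover have "\<psi> k = ?g ((?g ^^ n) c)" unfolding \<psi>_def k by (simp del: of_nat_Suc)
    ultimately show ?thesis using g gmem by simp
  qed
  have range: "range \<psi> = I0"
  proof (rule connected)
    fix i assume i: "i \<in> I1"
    show "l i \<in> range \<psi> \<longleftrightarrow> i \<in> range \<psi>"
    proof
      assume "l i \<in> range \<psi>"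
      then obtain k where "l i = \<psi> k" by auto
      then have "l i = l (\<psi> (k - 1))" using step[of "k - 1"] by simp
      then have "i = \<psi> (k - 1)" using i mem total inj by (auto dest: inj_onD)
      then show "i \<in> range \<psi>" by blast
    next
      assume "i \<in> range \<psi>"
      then show "l i \<in> range \<psi>" using step by (metis rangeE rangeI)
    qed
  qed (use mem in auto)
  have "inj \<psi>"
  proof (rule ccontr)
    assume "\<not> inj \<psi>"
    then obtain a b where "a < b" "\<psi> a = \<psi> b" by (metis injI linorder_neqE)
    then obtain d where d: "d > 0" "\<psi> (a + d) = \<psi> a" using that[of "b - a"] by simp
    have period: "\<psi> (k + d) = \<psi> k" for k
    proof (induction k rule: int_induct[where k = a])
      case base
      show ?case using d by simp
    next
      case (step1 i)
      then show ?case using step[of i] step[of "i + d"] by (simp add: algebra_simps)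
    next
      case (step2 i)
      then have "l (\<psi> (i - 1 + d)) = l (\<psi> (i - 1))"
        using step[of "i - 1"] step[of "i - 1 + d"] by (simp add: algebra_simps)
      then show ?case using mem total inj by (auto dest: inj_onD)
    qed
    have mult: "\<psi> (k + int n * d) = \<psi> k" for k n
    proof (induction n)
      case (Suc n)
      then show ?case using period[of "k + int n * d"] by (simp add: algebra_simps)
    qed simp
    have "\<psi> k = \<psi> (k mod d)" for k
    proof (cases "k div d \<ge> 0")
      case True
      then show ?thesis using mult[of "k mod d" "nat (k div d)"] by simp
    next
      case False
      have "k mod d = k + (- (k div d)) * d" by (simp add: minus_div_mult_eq_mod[symmetric])
      then show ?thesis using mult[of k "nat (- (k div d))"] False by simp
    qed
    then have "\<psi> k \<in> \<psi> ` {0..<d}" for k using d(1) by (intro image_eqI[of _ _ "k mod d"]) auto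
    then have "range \<psi> \<subseteq> \<psi> ` {0..<d}" by blast
    then show False using range infinite_index finite_surj by blast
  qed
  then show ?thesis using that[of \<psi>] range step by (simp add: bij_betw_def)
qed

end


section \<open>The classification\<close>

theorem theorem5p11:
  fixes G :: "'a res_lattice"
    and I0 I1 :: "'i set"
    and l :: "'i \<Rightarrow> 'i"
  assumes "integral_residuated_lattice G"
    and "rl_nontrivial G"
    and "I1 \<subseteq> I0"
    and "countable I0" and "infinite I0"
    and "l \<in> I1 \<rightarrow> I0" and "inj_on l I1"
    and "subdirectly_irreducible (kite I0 I1 l G)"
  shows "(rl_isomorphic (kite I0 I1 l G) (kite_Z G) \<and>
          \<not> rl_isomorphic (kite I0 I1 l G) (kite_N_pred G) \<and>
          \<not> rl_isomorphic (kite I0 I1 l G) (kite_N_succ G)) \<or>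
         (\<not> rl_isomorphic (kite I0 I1 l G) (kite_Z G) \<and>
          rl_isomorphic (kite I0 I1 l G) (kite_N_pred G) \<and>
          \<not> rl_isomorphic (kite I0 I1 l G) (kite_N_succ G)) \<or>
         (\<not> rl_isomorphic (kite I0 I1 l G) (kite_Z G) \<and>
          \<not> rl_isomorphic (kite I0 I1 l G) (kite_N_pred G) \<and>
          rl_isomorphic (kite I0 I1 l G) (kite_N_succ G))"
proof -
  interpret G: integral_residuated_lattice G by fact
  interpret K: kite_base I0 I1 l G
    by unfold_locales (fact assms)+
  interpret K: connected_frame I0 I1 l
    by unfold_locales (use assms K.kite_si_connected in blast)+
  interpret Z: kite_base "UNIV :: int set" UNIV "\<lambda>i. i + 1" G
    by unfold_locales (auto simp: inj_on_def)
  interpret P: kite_base "UNIV :: nat set" "UNIV - {0}" "\<lambda>i. i - 1" G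
    by unfold_locales (auto simp: inj_on_def)
  interpret S: kite_base "UNIV :: nat set" UNIV "\<lambda>i. i + 1" G
    by unfold_locales (auto simp: inj_on_def)
  have succ: "range (\<lambda>i::nat. i + 1) \<noteq> UNIV" by (metis rangeE UNIV_I add_is_0 one_neq_zero)
  have pred: "(\<lambda>i. i - 1) ` (UNIV - {0}) = (UNIV :: nat set)"
    by (auto intro!: image_eqI[of _ _ "Suc _"])
  have trans: "range (\<lambda>i::int. i + 1) = UNIV"
    by (auto intro!: image_eqI[of _ _ "_ - 1"])
  have Z_cancel: "pivots_left_cancel (kite_Z G)" "pivots_right_cancel (kite_Z G)"
    using Z.pivots_left_cancel_iff[OF assms(2), of 0 1] Z.pivots_right_cancel_iff[OF assms(2), of 0 1] trans
    by (simp_all add: kite_Z_def)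
  have P_cancel: "\<not> pivots_left_cancel (kite_N_pred G)" "pivots_right_cancel (kite_N_pred G)"
    using P.pivots_left_cancel_iff[OF assms(2), of 0 1] P.pivots_right_cancel_iff[OF assms(2), of 0 1] pred
    by (auto simp: kite_N_pred_def)
  have S_cancel: "pivots_left_cancel (kite_N_succ G)" "\<not> pivots_right_cancel (kite_N_succ G)"
    using S.pivots_left_cancel_iff[OF assms(2), of 0 1] S.pivots_right_cancel_iff[OF assms(2), of 0 1] succ
    by (simp_all add: kite_N_succ_def)
  note invariant = pivots_cancel_isomorphic[OF K.K.residuated_lattice_axioms]
  have exclusive: "\<not> (rl_isomorphic (kite I0 I1 l G) (kite_Z G) \<and> rl_isomorphic (kite I0 I1 l G) (kite_N_pred G))"
    "\<not> (rl_isomorphic (kite I0 I1 l G) (kite_Z G) \<and> rl_isomorphic (kite I0 I1 l G) (kite_N_succ G))"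
    "\<not> (rl_isomorphic (kite I0 I1 l G) (kite_N_pred G) \<and> rl_isomorphic (kite I0 I1 l G) (kite_N_succ G))"
    using invariant[of "kite_Z G"] invariant[of "kite_N_pred G"] invariant[of "kite_N_succ G"]
      Z_cancel P_cancel S_cancel by auto
  consider "I1 = I0" "l ` I1 = I0" | j where "j \<in> I0" "j \<notin> I1" "l ` I1 = I0"
    | k where "k \<in> I0" "k \<notin> l ` I1"
    using assms(3,6) by blast
  then show ?thesis
  proof cases
    case 1
    obtain \<psi> :: "int \<Rightarrow> 'i" where "bij_betw \<psi> UNIV I0" "\<And>k. \<psi> (k + 1) = l (\<psi> k)"
      using K.permutation_bij[OF 1] by blast
    then have "rl_isomorphic (kite I0 I1 l G) (kite_Z G)"
      unfolding kite_Z_def using 1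
      by (intro kite_relabel[OF K.kite_base_axioms Z.kite_frame_axioms, of \<psi>]) (auto dest: bij_betwE)
    then show ?thesis using exclusive by blast
  next
    case 2
    let ?\<psi> = "\<lambda>n. (inv_into I1 l ^^ n) j"
    have bij: "bij_betw ?\<psi> UNIV I0" using K.sink_bij[OF 2(3,1,2)] .
    then have mem: "?\<psi> n \<in> l ` I1" for n using 2(3) bij_betwE by blast
    have suc: "?\<psi> (Suc n) \<in> I1" "l (?\<psi> (Suc n)) = ?\<psi> n" for n
      using inv_into_into[OF mem[of n]] f_inv_into_f[OF mem[of n]] by simp_all
    have "?\<psi> n \<in> I1 \<longleftrightarrow> n \<in> UNIV - {0}" for n
      using 2(2) suc(1) by (cases n) auto
    moreover have "?\<psi> (n - 1) = l (?\<psi> n)" if "n \<in> UNIV - {0}" for n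
      using suc(2)[of "n - 1"] that by (cases n) auto
    ultimately have "rl_isomorphic (kite I0 I1 l G) (kite_N_pred G)"
      unfolding kite_N_pred_def using bij
      by (intro kite_relabel[OF K.kite_base_axioms P.kite_frame_axioms, of ?\<psi>]) auto
    then show ?thesis using exclusive by blast
  next
    case 3
    have "bij_betw (\<lambda>n. (l ^^ n) k) UNIV I0" "I1 = I0"
      using K.source_bij[OF 3] K.source_total[OF 3] by auto
    then have "rl_isomorphic (kite I0 I1 l G) (kite_N_succ G)"
      unfolding kite_N_succ_def
      by (intro kite_relabel[OF K.kite_base_axioms S.kite_frame_axioms, of "\<lambda>n. (l ^^ n) k"])
        (auto dest: bij_betwE)
    then show ?thesis using exclusive by blast
  qed
qed

end
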